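(* Let $n\ge 1$ be an integer, let $S$ be a basis of $\mathbb{R}^{n}$, and let $A,B\subseteq \mathbb{R}^{n}$ satisfy $S+S\subseteq A+B$. Let $t$ be an integer with $0\le t\le n-1$. If $|A|\le n-t$, then $|B|\ge n+\binom{t+1}{2}$.
   Context: For sets $X,Y\subseteq\mathbb{R}^n$, $X+Y=\{x+y: x\in X,\ y\in Y\}$; in particular $S+S=\{s+s': s,s'\in S\}$ (including $s=s'$). *)

theory Defs
  imports "HOL-Analysis.Analysis" "HOL-Library.Set_Algebras"
begin

end

theory Submission
  imports Defs
begin

text \<open>
  Put \<open>t = |S| - |A|\<close> and induct on \<open>|S|\<close>. The case \<open>t = 0\<close> follows from \<open>t \<ge> 1\<close> by exchanging
  \<open>A\<close> and \<open>B\<close>. For \<open>R \<subseteq> S\<close> let \<open>f\<close> collapse \<open>R\<close> to a point, let \<open>p = |A| - |f(A)|\<close> and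
  \<open>\<tau> = |R| - 1 - p\<close>. Modulo the at most \<open>p\<close>-dimensional span of the differences inside the fibers
  of \<open>f\<close> on \<open>A\<close>, the image of \<open>R\<close> has affine dimension at least \<open>\<tau>\<close>. As in the proof of Freiman's
  lemma, an extreme point \<open>T\<close> of this image then has \<open>\<tau>\<close> further classes \<open>X\<close> such that the elements of
  \<open>B\<close> covering \<open>T + X\<close> cover no other sums, and likewise for \<open>T + T\<close>. Starting from \<open>R = S\<close>, where
  \<open>\<tau> \<ge> t\<close>, one descends to a smallest \<open>R\<close> having \<open>t\<close> such classes, so \<open>\<tau> < t\<close>. If \<open>|R| = 1\<close>,
  delete \<open>R\<close> from \<open>S\<close>, which frees \<open>t + 1\<close> elements of \<open>B\<close>. Otherwise apply \<open>f\<close>: all but one of the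
  elements covering \<open>R + R\<close> become superfluous (there are at least \<open>|R| + \<tau>\<close> of them, by induction
  applied to \<open>R\<close>), and so do \<open>max(\<tau>, 0)\<close> elements for each of the \<open>t\<close> classes. In both cases the
  induction hypothesis for the image of \<open>S\<close> gives the bound.
\<close>

section \<open>Inequalities for binomial coefficients\<close>

lemma double_choose_two: "2 * (n + 1 choose 2) = n * (n + 1)" for n :: nat
  by (induction n) (auto simp: numeral_2_eq_2)

text \<open>Applied with \<open>y = \<tau>\<close> and \<open>x = t - \<tau>\<close>: when a
  collapse lowers \<open>t\<close> by \<open>\<tau>\<close>, the elements saved by the
  \<open>t\<close> classes and by \<open>R + R\<close> pay for the loss in the binomial
  term.\<close>

lemma choose_two_diff_le:
  fixes x y :: nat
  shows "(x + y + 1 choose 2) \<le> (x + 1 choose 2) + (x + y) * y + y"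
proof -
  have "2 * (x + y + 1 choose 2) \<le> 2 * ((x + 1 choose 2) + (x + y) * y + y)"
    unfolding distrib_left double_choose_two by (simp add: algebra_simps)
  then show ?thesis by simp
qed

text \<open>Serves a collapse that raises \<open>t\<close> by \<open>d\<close>; with
  \<open>t = 0\<close> it yields \<open>d \<le> (d + 1 choose 2)\<close>.\<close>

lemma choose_two_add_le:
  fixes t d :: nat
  shows "(t + 1 choose 2) + d \<le> (t + d + 1 choose 2)"
proof -
  have "d \<le> d * d" by (cases d) auto
  then have "d \<le> d * d + (d * t + d * t)" by linarith
  then have "2 * ((t + 1 choose 2) + d) \<le> 2 * (t + d + 1 choose 2)"
    unfolding distrib_left double_choose_two by (simp add: algebra_simps)
  then show ?thesis by simp
qed

section \<open>Orthogonality, fibers of a collapsing map, and lower bounds for covering sets\<close>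

text \<open>A vector that works for \<open>F\<close> is perturbed by a generic multiple of the
  component of the new vector orthogonal to \<open>V\<close>.\<close>

lemma exists_separating_vector:
  fixes V F :: "'a :: euclidean_space set"
  assumes "subspace V" "finite F" "F \<inter> V = {}"
  shows "\<exists>y. (\<forall>v\<in>V. y \<bullet> v = 0) \<and> (\<forall>u\<in>F. y \<bullet> u \<noteq> 0)"
  using assms(2,3)
proof (induction F rule: finite_induct)
  case empty
  then show ?case by (auto intro: exI[of _ 0])
next
  case (insert u F)
  then obtain y where y: "\<forall>v\<in>V. y \<bullet> v = 0" "\<forall>u\<in>F. y \<bullet> u \<noteq> 0" by auto
  obtain w z where wz: "w \<in> span V" "\<And>v. v \<in> span V \<Longrightarrow> orthogonal z v" "u = w + z"
    using orthogonal_subspace_decomp_exists[of V u] by metis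
  have zV: "z \<bullet> v = 0" if "v \<in> V" for v
    using wz(2)[of v] that by (auto simp: orthogonal_def span_base)
  have "z \<noteq> 0" using wz(1,3) insert.prems unfolding iffD2[OF span_eq_iff assms(1)] by auto
  then have zu: "z \<bullet> u \<noteq> 0"
    using wz(1,3) wz(2)[of w] by (simp add: inner_add_right orthogonal_def)
  \<comment> \<open>Each \<open>v\<close> with \<open>z \<bullet> v \<noteq> 0\<close> is orthogonal
    to \<open>y + e *\<^sub>R z\<close> for just one \<open>e\<close>, so only finitely many values
    have to be avoided.\<close>
  obtain e where e: "e \<notin> (\<lambda>v. - (y \<bullet> v) / (z \<bullet> v)) ` (insert u F) \<union> {0 :: real}"
    using ex_new_if_finite[OF infinite_UNIV_char_0] insert.hyps
    by (metis finite.insertI finite_UnI finite_imageI finite.emptyI)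
  have "(y + e *\<^sub>R z) \<bullet> v \<noteq> 0" if "v \<in> insert u F" for v
  proof
    assume 0: "(y + e *\<^sub>R z) \<bullet> v = 0"
    show False
    proof (cases "z \<bullet> v = 0")
      case True
      then show False using 0 that y(2) zu by (auto simp: inner_add_left)
    next
      case False
      then have "e = - (y \<bullet> v) / (z \<bullet> v)" using 0 by (simp add: inner_add_left field_simps)
      then show False using e that by blast
    qed
  qed
  moreover have "(y + e *\<^sub>R z) \<bullet> v = 0" if "v \<in> V" for v
    using that y(1) zV by (simp add: inner_add_left)
  ultimately show ?case by blast
qed

text \<open>\<open>inv_into\<close> picks a representative of each fiber; \<open>Q\<close> holds the
  differences between the other elements of \<open>A\<close> and their representatives.\<close>

lemma fiber_differences:
  fixes A :: "'a :: real_vector set" and f :: "'a \<Rightarrow> 'b"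
  assumes "finite A"
  obtains Q where "finite Q" "card Q + card (f ` A) \<le> card A"
    "\<And>a. a \<in> A \<Longrightarrow> a - inv_into A f (f a) \<in> insert 0 Q"
proof
  let ?N = "A - inv_into A f ` f ` A"
  let ?Q = "(\<lambda>a. a - inv_into A f (f a)) ` ?N"
  show "finite ?Q" using assms by simp
  have sub: "inv_into A f ` f ` A \<subseteq> A" by (auto intro: inv_into_into)
  have "card (inv_into A f ` f ` A) = card (f ` A)"
    by (intro card_image inj_on_inv_into) auto
  moreover have "card ?N = card A - card (inv_into A f ` f ` A)"
    using sub assms by (intro card_Diff_subset) (auto intro: finite_subset)
  moreover have "card ?Q \<le> card ?N" using assms by (intro card_image_le) auto
  moreover have "card (f ` A) \<le> card A" using assms by (rule card_image_le)
  ultimately show "card ?Q + card (f ` A) \<le> card A" by linarith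
  show "a - inv_into A f (f a) \<in> insert 0 ?Q" if a: "a \<in> A" for a
  proof (cases "a \<in> ?N")
    case False
    then obtain a' where a': "a' \<in> A" "a = inv_into A f (f a')" using a by blast
    then have "f a = f a'" by (simp add: f_inv_into_f)
    then show ?thesis using a' by simp
  qed auto
qed

text \<open>Translating each fiber of \<open>f\<close> in \<open>A\<close> to the origin, and \<open>Z\<close> by the opposite vectors, still covers
  \<open>R + R\<close> because \<open>f\<close> is constant there.\<close>
lemma merged_sum_bound:
  fixes A Z R :: "'a :: real_vector set" and f :: "'a \<Rightarrow> 'a"
  assumes bound: "\<And>A B. finite A \<Longrightarrow> finite B \<Longrightarrow> R + R \<subseteq> A + B \<Longrightarrow> 2 * card R \<le> card A + card B"
    and fin: "finite A" "finite Z" and f: "linear f" "\<forall>s\<in>R. f s = c"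
    and cov: "R + R \<subseteq> A + Z"
  shows "2 * card R + card (f ` A) \<le> card Z + card A + 1"
proof -
  obtain Q where Q: "finite Q" "card Q + card (f ` A) \<le> card A"
    "\<And>a. a \<in> A \<Longrightarrow> a - inv_into A f (f a) \<in> insert 0 Q"
    using fiber_differences[OF fin(1), where f = f] by blast
  let ?Z = "(\<lambda>b. b + inv_into A f (c + c - f b)) ` Z"
  have "R + R \<subseteq> insert 0 Q + ?Z"
  proof
    fix x assume "x \<in> R + R"
    then obtain s s' where s: "s \<in> R" "s' \<in> R" "x = s + s'" by (auto elim: set_plus_elim)
    obtain a b where ab: "a \<in> A" "b \<in> Z" "x = a + b"
      using \<open>x \<in> R + R\<close> cov by (blast elim: set_plus_elim)
    have "f x = c + c" using s f by (simp add: linear_add)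
    then have "f a = c + c - f b" using ab f(1) by (simp add: linear_add algebra_simps)
    then have eq: "x = (a - inv_into A f (f a)) + (b + inv_into A f (c + c - f b))"
      using ab by simp
    show "x \<in> insert 0 Q + ?Z"
      unfolding eq using Q(3)[OF ab(1)] ab(2) by (intro set_plus_intro imageI)
  qed
  then have "2 * card R \<le> card (insert 0 Q) + card ?Z"
    using Q(1) fin(2) by (intro bound) simp_all
  moreover have "card ?Z \<le> card Z" using fin(2) by (rule card_image_le)
  moreover have "card (insert 0 Q) \<le> card Q + 1" using Q(1) by (simp add: card_insert_if)
  ultimately show ?thesis using Q(2) by linarith
qed

text \<open>The same translation of fibers turns the equations \<open>s + i = a + b\<close> into a
  spanning set for \<open>R\<close> made of \<open>i\<close>, \<open>Q\<close> and one vector for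
  each element of \<open>Z\<close>; independence of \<open>insert i R\<close> bounds its size from
  below.\<close>

lemma merged_star_bound:
  fixes A Z R :: "'a :: euclidean_space set" and f :: "'a \<Rightarrow> 'a"
  assumes ind: "independent (insert i R)" "i \<notin> R"
    and fin: "finite A" "finite Z" and f: "linear f" "\<forall>s\<in>R. f s = c"
    and cov: "\<And>s. s \<in> R \<Longrightarrow> \<exists>b\<in>Z. s + i - b \<in> A"
  shows "card R + card (f ` A) \<le> card Z + card A"
proof -
  obtain Q where Q: "finite Q" "card Q + card (f ` A) \<le> card A"
    "\<And>a. a \<in> A \<Longrightarrow> a - inv_into A f (f a) \<in> insert 0 Q"
    using fiber_differences[OF fin(1), where f = f] by blast
  let ?Z = "(\<lambda>b. b + inv_into A f (c + f i - f b)) ` Z"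
  let ?G = "insert i (Q \<union> ?Z)"
  have "s \<in> span ?G" if s: "s \<in> R" for s
  proof -
    obtain b where b: "b \<in> Z" "s + i - b \<in> A" using cov[OF s] by blast
    let ?a = "s + i - b"
    have "f ?a = c + f i - f b" using s f by (simp add: linear_add linear_diff)
    then have eq: "s = (?a - inv_into A f (f ?a)) + (b + inv_into A f (c + f i - f b)) - i"
      by simp
    have 1: "?a - inv_into A f (f ?a) \<in> span ?G"
      using Q(3)[OF b(2)] by (auto intro: span_base span_zero)
    have 2: "b + inv_into A f (c + f i - f b) \<in> span ?G"
      using b(1) by (intro span_base) auto
    have "i \<in> span ?G" by (intro span_base) auto
    from span_diff[OF span_add[OF 1 2] this] show ?thesis using eq by simp
  qed
  then have "insert i R \<subseteq> span ?G" by (auto intro: span_base)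
  then have "card (insert i R) \<le> card ?G"
    using independent_span_bound[OF _ ind(1)] Q(1) fin(2) by auto
  moreover have "finite R" using independent_imp_finite[OF ind(1)] by simp
  moreover have "card ?G \<le> 1 + (card Q + card ?Z)"
    using card_Un_le[of Q ?Z] Q(1) fin(2) by (simp add: card_insert_if)
  moreover have "card ?Z \<le> card Z" using fin(2) by (rule card_image_le)
  ultimately show ?thesis using Q(2) ind(2) by simp
qed

section \<open>Isolated classes at an extreme point\<close>

text \<open>An element \<open>b\<close> covers the sum \<open>u + w\<close> if \<open>u + w - b \<in> A\<close>.\<close>
definition isolated :: "'a::ab_group_add set \<Rightarrow> 'a set \<Rightarrow> 'a set \<Rightarrow> 'a set \<Rightarrow> bool" where
  "isolated S A R X \<longleftrightarrow>
    (\<forall>b. \<forall>u\<in>R. \<forall>w\<in>X. \<forall>k\<in>S. \<forall>l\<in>S. u + w - b \<in> A \<longrightarrow> k + l - b \<in> A \<longrightarrow>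
      (k \<in> R \<and> l \<in> X \<or> k \<in> X \<and> l \<in> R))"

text \<open>\<open>\<F>\<close> is the family of classes from the overview. Only its size
  \<open>m\<close> is a parameter, so that a smallest \<open>R\<close> can be chosen for a fixed
  number of classes.\<close>

definition peeled :: "'a::ab_group_add set \<Rightarrow> 'a set \<Rightarrow> nat \<Rightarrow> 'a set \<Rightarrow> bool" where
  "peeled S A m R \<longleftrightarrow> R \<subseteq> S \<and> R \<noteq> {} \<and> isolated S A R R \<and>
    (\<exists>\<F>. finite \<F> \<and> card \<F> = m \<and> disjoint \<F> \<and>
      (\<forall>X\<in>\<F>. X \<subseteq> S - R \<and> X \<noteq> {} \<and> isolated S A R X))"

text \<open>\<open>T\<close> is the face of \<open>R\<close> on which a functional vanishing on
  \<open>V\<close> is minimal, and the classes are other level sets of it in \<open>R\<close>.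
  Isolation confines every sum sharing a covering element with \<open>R + R\<close> to
  \<open>R + R\<close>, where \<open>f\<close> is constant, so two such sums agree modulo
  \<open>V\<close>.\<close>

lemma exists_peeled:
  fixes S A R :: "'a :: euclidean_space set"
  assumes S: "independent S" and R: "R \<subseteq> S" "R \<noteq> {}" "isolated S A R R"
    and fin: "finite A" and f: "linear f" "\<forall>s\<in>R. f s = c"
    and m: "card A + 1 + m \<le> card R + card (f ` A)"
  shows "\<exists>T\<subseteq>R. peeled S A m T \<and> (m > 0 \<longrightarrow> T \<noteq> R)"
proof -
  obtain Q where Q: "finite Q" "card Q + card (f ` A) \<le> card A"
    "\<And>a. a \<in> A \<Longrightarrow> a - inv_into A f (f a) \<in> insert 0 Q"
    using fiber_differences[OF fin, where f = f] by blast
  define V where "V = span Q"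
  have sV: "subspace V" unfolding V_def by simp
  have fib: "a - a' \<in> V" if "a \<in> A" "a' \<in> A" "f a = f a'" for a a'
  proof -
    have "a - inv_into A f (f a) \<in> V" "a' - inv_into A f (f a') \<in> V"
      using that(1,2)[THEN Q(3)] unfolding V_def by (auto intro: span_base span_zero)
    from subspace_diff[OF sV this] show ?thesis using that(3) by simp
  qed
  have finR: "finite R" using S R(1) independent_imp_finite finite_subset by blast
  \<comment> \<open>\<open>y\<close> is orthogonal to \<open>V\<close> but to no difference of
    \<open>R\<close> outside \<open>V\<close>, so its level sets on \<open>R\<close> are exactly the
    classes modulo \<open>V\<close>.\<close>
  obtain y where y: "\<forall>v\<in>V. y \<bullet> v = 0"
    "\<forall>u\<in>(\<lambda>(s, s'). s - s') ` (R \<times> R) - V. y \<bullet> u \<noteq> 0"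
    using exists_separating_vector[OF sV, of "(\<lambda>(s, s'). s - s') ` (R \<times> R) - V"] finR
    by (metis Diff_disjoint Int_commute finite_Diff finite_SigmaI finite_imageI)
  define h where "h = (\<lambda>u. y \<bullet> u)"
  have hadd: "h (u + w) = h u + h w" for u w unfolding h_def by (simp add: inner_add_right)
  have hV: "h u = h w" if "u - w \<in> V" for u w
    using y(1)[rule_format, OF that] unfolding h_def by (simp add: inner_diff_right)
  have sep: "s - s' \<in> V" if "s \<in> R" "s' \<in> R" "h s = h s'" for s s'
  proof (rule ccontr)
    assume "s - s' \<notin> V"
    then have "s - s' \<in> (\<lambda>(s, s'). s - s') ` (R \<times> R) - V" using that by force
    with y(2) have "y \<bullet> (s - s') \<noteq> 0" by blast
    then show False using that(3) unfolding h_def by (simp add: inner_diff_right)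
  qed
  define \<mu> where "\<mu> = Min (h ` R)"
  have \<mu>_le: "\<mu> \<le> h s" if "s \<in> R" for s unfolding \<mu>_def using finR that by simp
  define T where "T = {s \<in> R. h s = \<mu>}"
  have "\<mu> \<in> h ` R" unfolding \<mu>_def using finR R(2) by (intro Min_in) auto
  then obtain x where x: "x \<in> R" "h x = \<mu>" by auto
  have collide: "k \<in> R \<and> l \<in> R \<and> u + w - (k + l) \<in> V"
    if "u \<in> R" "w \<in> R" "k \<in> S" "l \<in> S" "u + w - b \<in> A" "k + l - b \<in> A" for u w k l b
  proof -
    have kl: "k \<in> R" "l \<in> R" using R(3)[unfolded isolated_def, rule_format, OF that] by auto
    have "f (u + w - b) = f (k + l - b)"
      using f kl that by (simp add: linear_add linear_diff)
    from fib[OF that(5,6) this] kl show ?thesis by simp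
  qed
  \<comment> \<open>The elements \<open>s\<close> for which \<open>s - x\<close> is, modulo \<open>V\<close>, no sum of two \<open>h\<close>-positive elements of
    \<open>R - x\<close>. By descent on \<open>h\<close> they generate \<open>R - x\<close> modulo \<open>V\<close>, hence there are many of them.\<close>
  define I where "I = {s \<in> R - T. \<forall>u\<in>R - T. \<forall>w\<in>R - T. x + s - (u + w) \<notin> V}"
  define F where "F \<alpha> = {s \<in> R. h s = \<alpha>}" for \<alpha>
  have isoT: "isolated S A T T"
    unfolding isolated_def
  proof (intro allI ballI impI)
    fix b u w k l assume *: "u \<in> T" "w \<in> T" "k \<in> S" "l \<in> S" "u + w - b \<in> A" "k + l - b \<in> A"
    then have c: "k \<in> R" "l \<in> R" "u + w - (k + l) \<in> V" using collide[of u w k l b] by (auto simp: T_def)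
    then have "h k + h l = \<mu> + \<mu>" using hV[OF c(3)] * by (simp add: hadd T_def)
    then have "h k = \<mu>" "h l = \<mu>" using \<mu>_le[OF c(1)] \<mu>_le[OF c(2)] by linarith+
    then show "k \<in> T \<and> l \<in> T \<or> k \<in> T \<and> l \<in> T" using c by (simp add: T_def)
  qed
  have isoF: "isolated S A T (F \<alpha>)" if \<alpha>: "\<alpha> \<in> h ` I" for \<alpha>
    unfolding isolated_def
  proof (intro allI ballI impI)
    fix b u w k l assume *: "u \<in> T" "w \<in> F \<alpha>" "k \<in> S" "l \<in> S" "u + w - b \<in> A" "k + l - b \<in> A"
    obtain s where s: "s \<in> I" "h s = \<alpha>" using \<alpha> by auto
    have c: "k \<in> R" "l \<in> R" "u + w - (k + l) \<in> V"
      using collide[of u w k l b] * by (auto simp: T_def F_def)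
    have sum: "h k + h l = \<mu> + \<alpha>" using hV[OF c(3)] * by (simp add: hadd T_def F_def)
    \<comment> \<open>Modulo \<open>V\<close>, \<open>x + s\<close> equals \<open>k + l\<close>;
      since \<open>s \<in> I\<close>, the elements \<open>k\<close> and \<open>l\<close> are not
      both outside \<open>T\<close>.\<close>
    have "x - u \<in> V" "s - w \<in> V" using sep x * s by (auto simp: T_def F_def I_def)
    then have "(x - u) + (s - w) + (u + w - (k + l)) \<in> V"
      using c(3) subspace_add[OF sV] by blast
    then have "x + s - (k + l) \<in> V" by (simp add: algebra_simps)
    then have "k \<in> T \<or> l \<in> T" using s(1) c(1,2) by (auto simp: I_def)
    then show "k \<in> T \<and> l \<in> F \<alpha> \<or> k \<in> F \<alpha> \<and> l \<in> T" using c sum by (auto simp: T_def F_def)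
  qed
  have finI: "finite I" using finR by (simp add: I_def)
  \<comment> \<open>One vector for each value of \<open>h\<close> on \<open>I\<close> suffices,
    because elements of \<open>R\<close> of equal height agree modulo \<open>V\<close>.\<close>
  define G where "G = insert x (Q \<union> (\<lambda>\<alpha>. inv_into I h \<alpha> - x) ` h ` I)"
  have gen: "s - x \<in> span G" if "s \<in> R" for s
    using that
  proof (induction "card {s' \<in> R. h s' < h s}" arbitrary: s rule: less_induct)
    case less
    have VG: "v \<in> span G" if "v \<in> V" for v
      using that unfolding V_def G_def by (meson span_mono subsetD subset_insertI2 sup_ge1)
    consider "s \<in> T" | "s \<in> I" | u w where "s \<notin> T" "u \<in> R - T" "w \<in> R - T" "x + s - (u + w) \<in> V"
      using less.prems by (auto simp: I_def)
    then show ?case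
    proof cases
      case 1
      then show ?thesis using sep[of s x] x VG by (auto simp: T_def)
    next
      case 2
      let ?s = "inv_into I h (h s)"
      have "?s \<in> I" "h ?s = h s" using 2 by (auto intro: inv_into_into f_inv_into_f)
      then have "s - ?s \<in> span G" using VG sep less.prems by (auto simp: I_def)
      moreover have "?s - x \<in> span G" using 2 by (intro span_base) (auto simp: G_def)
      ultimately have "(s - ?s) + (?s - x) \<in> span G" by (rule span_add)
      then show ?thesis by simp
    next
      case 3
      have "\<mu> + h s = h u + h w" using hV[OF 3(4)] x by (simp add: hadd)
      moreover have "\<mu> < h u" "\<mu> < h w" using 3 \<mu>_le[of u] \<mu>_le[of w] by (auto simp: T_def order.strict_iff_order)
      ultimately have lt: "h u < h s" "h w < h s" by auto
      have dec: "card {s' \<in> R. h s' < h v} < card {s' \<in> R. h s' < h s}" if "v \<in> R" "h v < h s" for v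
        using finR that by (intro psubset_card_mono psubsetI) auto
      have "u - x \<in> span G" "w - x \<in> span G" using less.hyps dec lt 3 by auto
      then have "(u - x) + (w - x) + (x + s - (u + w)) \<in> span G"
        using VG[OF 3(4)] by (intro span_add[OF span_add])
      then show ?thesis by (simp add: algebra_simps)
    qed
  qed
  have "R \<subseteq> span G"
  proof
    fix s assume "s \<in> R"
    then have "(s - x) + x \<in> span G" using gen by (intro span_add) (auto simp: G_def span_base)
    then show "s \<in> span G" by simp
  qed
  moreover have "finite G" using Q(1) finI by (simp add: G_def)
  ultimately have "card R \<le> card G"
    using independent_span_bound[of G R] independent_mono[OF S R(1)] by simp
  moreover have "card G \<le> 1 + (card Q + card (h ` I))"
  proof -
    have "card G \<le> Suc (card (Q \<union> (\<lambda>\<alpha>. inv_into I h \<alpha> - x) ` h ` I))"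
      unfolding G_def using Q(1) finI by (simp add: card_insert_if)
    also have "\<dots> \<le> Suc (card Q + card ((\<lambda>\<alpha>. inv_into I h \<alpha> - x) ` h ` I))"
      using card_Un_le by auto
    finally show ?thesis using card_image_le[of "h ` I" "\<lambda>\<alpha>. inv_into I h \<alpha> - x"] finI by simp
  qed
  \<comment> \<open>Independence bounds \<open>card R\<close> by \<open>1 + card Q\<close> plus the
    number of heights in \<open>I\<close>; the bound on \<open>card Q\<close> then leaves at least
    \<open>m\<close> heights.\<close>
  ultimately have "m \<le> card (h ` I)" using Q(2) m by linarith
  then obtain J where J: "J \<subseteq> h ` I" "card J = m" "finite J"
    by (meson obtain_subset_with_card_n)
  have Fne: "F \<alpha> \<noteq> {}" if "\<alpha> \<in> J" for \<alpha> using that J(1) by (auto simp: F_def I_def)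
  have "inj_on F J" using Fne by (intro inj_onI) (fastforce simp: F_def)
  then have "card (F ` J) = m" using J by (simp add: card_image)
  moreover have "disjoint (F ` J)" by (auto simp: disjoint_def F_def)
  moreover have "F \<alpha> \<subseteq> S - T" if "\<alpha> \<in> J" for \<alpha>
    using that J(1) R(1) by (auto simp: F_def I_def T_def)
  ultimately have "peeled S A m T"
    unfolding peeled_def using isoT isoF Fne J R(1) x
    by (intro conjI exI[of _ "F ` J"]) (auto simp: T_def)
  moreover have "T \<noteq> R" if m0: "m > 0"
  proof -
    obtain \<alpha> where "\<alpha> \<in> J" using J(2) m0 by fastforce
    then obtain s where "s \<in> I" using J(1) by blast
    then show ?thesis by (auto simp: I_def)
  qed
  ultimately show ?thesis by (intro exI[of _ T]) (auto simp: T_def)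
qed

definition touched :: "'a::ab_group_add set \<Rightarrow> 'a set \<Rightarrow> 'a set \<Rightarrow> 'a set \<Rightarrow> 'a set" where
  "touched A B R X = {b \<in> B. \<exists>u\<in>R. \<exists>w\<in>X. u + w - b \<in> A}"

lemma touched_isolated:
  assumes "isolated S A R X" "R \<subseteq> S" "X \<subseteq> S" "b \<in> touched A B R X"
    "k \<in> S" "l \<in> S" "k + l - b \<in> A"
  shows "k \<in> R \<and> l \<in> X \<or> k \<in> X \<and> l \<in> R"
proof -
  obtain u w where "u \<in> R" "w \<in> X" "u + w - b \<in> A" using assms(4) by (auto simp: touched_def)
  then show ?thesis
    using assms(1)[unfolded isolated_def, rule_format, of u w k l b] assms(5-7) by blast
qed

lemma covered_sum:
  fixes A B :: "'a::ab_group_add set"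
  assumes "S + S \<subseteq> A + B" "k \<in> S" "l \<in> S"
  shows "\<exists>b\<in>B. k + l - b \<in> A"
proof -
  have "k + l \<in> A + B" using assms by (blast intro: set_plus_intro)
  then obtain a b where "a \<in> A" "b \<in> B" "k + l = a + b" by (rule set_plus_elim)
  then show ?thesis by (intro bexI[of _ b]) simp_all
qed

text \<open>\<open>D\<close> is \<open>D0\<close> together with \<open>\<tau>\<close> elements for
  each class. By isolation no element serves two classes, or \<open>R + R\<close> and a class, so
  the count is exact; and a given \<open>i\<close> meets the removed elements of at most one
  class.\<close>

lemma peeled_removal:
  assumes peel: "peeled S A m R" and finB: "finite B" and D0: "D0 \<subseteq> touched A B R R"
    and many: "\<And>i. i \<in> S - R \<Longrightarrow> \<tau> \<le> card (touched A B R {i})"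
  obtains D where "D \<subseteq> B" "card D = card D0 + m * \<tau>"
    "\<And>b k l. b \<in> D \<Longrightarrow> k \<in> S \<Longrightarrow> l \<in> S \<Longrightarrow> k + l - b \<in> A \<Longrightarrow>
      k \<in> R \<and> l \<in> R \<and> b \<in> D0 \<or> k \<in> R \<and> l \<notin> R \<or> k \<notin> R \<and> l \<in> R"
    "\<And>i. i \<in> S - R \<Longrightarrow> card (D \<inter> touched A B R {i}) \<le> \<tau>"
proof -
  obtain \<F> where RS: "R \<subseteq> S" and isoR: "isolated S A R R"
    and F: "finite \<F>" "card \<F> = m" "disjoint \<F>"
      "\<And>X. X \<in> \<F> \<Longrightarrow> X \<subseteq> S - R \<and> X \<noteq> {} \<and> isolated S A R X"
    using peel unfolding peeled_def by auto
  have fint: "finite (touched A B R X)" for X using finB by (simp add: touched_def)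
  have "\<exists>E. E \<subseteq> touched A B R X \<and> card E = \<tau>" if X: "X \<in> \<F>" for X
  proof -
    obtain i where "i \<in> X" using F(4)[OF X] by blast
    then have "i \<in> S - R" "touched A B R {i} \<subseteq> touched A B R X"
      using F(4)[OF X] by (auto simp: touched_def)
    then have "\<tau> \<le> card (touched A B R X)"
      using many card_mono[OF fint] by (meson le_trans)
    then show ?thesis by (meson obtain_subset_with_card_n)
  qed
  then obtain E where E: "\<And>X. X \<in> \<F> \<Longrightarrow> E X \<subseteq> touched A B R X" "\<And>X. X \<in> \<F> \<Longrightarrow> card (E X) = \<tau>"
    by metis
  have finE: "finite (E X)" if "X \<in> \<F>" for X using E(1)[OF that] fint finite_subset by blast
  have finD0: "finite D0" using D0 fint finite_subset by blast
  have in_R: "k \<in> R \<and> l \<in> R" if "b \<in> D0" "k \<in> S" "l \<in> S" "k + l - b \<in> A" for b k l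
    using touched_isolated[OF isoR RS RS _ that(2-4)] D0 that(1) by blast
  have in_X: "k \<in> R \<and> l \<in> X \<or> k \<in> X \<and> l \<in> R"
    if "X \<in> \<F>" "b \<in> E X" "k \<in> S" "l \<in> S" "k + l - b \<in> A" for b k l X
    using touched_isolated[OF _ RS _ _ that(3-5), of X B] F(4)[OF that(1)] E(1)[OF that(1)] that(2)
    by blast
  have edge: "\<exists>u\<in>R. \<exists>w\<in>X. u \<in> S \<and> w \<in> S \<and> w \<notin> R \<and> u + w - b \<in> A" if "X \<in> \<F>" "b \<in> E X" for b X
    using E(1)[OF that(1)] that(2) F(4)[OF that(1)] RS unfolding touched_def by blast
  have disjE: "E X \<inter> E Y = {}" if XY: "X \<in> \<F>" "Y \<in> \<F>" "X \<noteq> Y" for X Y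
  proof (rule ccontr)
    assume "E X \<inter> E Y \<noteq> {}"
    then obtain b where b: "b \<in> E X" "b \<in> E Y" by blast
    obtain u w where "u \<in> R" "w \<in> X" "u \<in> S" "w \<in> S" "w \<notin> R" "u + w - b \<in> A"
      using edge[OF XY(1) b(1)] by blast
    then have "w \<in> Y" using in_X[OF XY(2) b(2), of u w] by blast
    then show False using \<open>w \<in> X\<close> F(3) XY by (auto simp: disjoint_def)
  qed
  have disjD: "D0 \<inter> (\<Union>X\<in>\<F>. E X) = {}"
  proof (rule ccontr)
    assume "D0 \<inter> (\<Union>X\<in>\<F>. E X) \<noteq> {}"
    then obtain b X where b: "b \<in> D0" "X \<in> \<F>" "b \<in> E X" by blast
    obtain u w where "u \<in> S" "w \<in> S" "w \<notin> R" "u + w - b \<in> A" using edge[OF b(2,3)] by blast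
    then show False using in_R[OF b(1)] by blast
  qed
  define D where "D = D0 \<union> (\<Union>X\<in>\<F>. E X)"
  have "D \<subseteq> B" using D0 E(1) unfolding D_def touched_def by blast
  moreover have "card D = card D0 + m * \<tau>"
  proof -
    have "card (\<Union>X\<in>\<F>. E X) = (\<Sum>X\<in>\<F>. card (E X))"
      using F(1) finE disjE by (intro card_UN_disjoint) auto
    also have "\<dots> = m * \<tau>" using E(2) F(2) by simp
    finally show ?thesis
      unfolding D_def using disjD finD0 F(1) finE by (subst card_Un_disjoint) auto
  qed
  moreover have "k \<in> R \<and> l \<in> R \<and> b \<in> D0 \<or> k \<in> R \<and> l \<notin> R \<or> k \<notin> R \<and> l \<in> R"
    if b: "b \<in> D" and kl: "k \<in> S" "l \<in> S" "k + l - b \<in> A" for b k l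
  proof (cases "b \<in> D0")
    case True
    then show ?thesis using in_R kl by blast
  next
    case False
    then obtain X where X: "X \<in> \<F>" "b \<in> E X" using b by (auto simp: D_def)
    show ?thesis using in_X[OF X kl] F(4)[OF X(1)] by blast
  qed
  moreover have "card (D \<inter> touched A B R {i}) \<le> \<tau>" if i: "i \<in> S - R" for i
  proof -
    \<comment> \<open>An element of \<open>D\<close> covering a sum of \<open>i\<close> with an
      element of \<open>R\<close> was chosen for the class that contains \<open>i\<close>.\<close>
    have loc: "\<exists>X\<in>\<F>. i \<in> X \<and> b \<in> E X" if b: "b \<in> D \<inter> touched A B R {i}" for b
    proof -
      obtain u where u: "u \<in> R" "u + i - b \<in> A" using b by (auto simp: touched_def)
      then have uS: "u \<in> S" using RS by blast
      have "b \<notin> D0" using in_R[OF _ uS _ u(2)] i by blast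
      then obtain X where X: "X \<in> \<F>" "b \<in> E X" using b by (auto simp: D_def)
      then show ?thesis using in_X[OF X uS _ u(2)] i by blast
    qed
    show ?thesis
    proof (cases "D \<inter> touched A B R {i} = {}")
      case False
      then obtain b where "b \<in> D \<inter> touched A B R {i}" by blast
      from loc[OF this] obtain X where X: "X \<in> \<F>" "i \<in> X" by blast
      have "D \<inter> touched A B R {i} \<subseteq> E X"
      proof
        fix b assume "b \<in> D \<inter> touched A B R {i}"
        from loc[OF this] obtain Y where "Y \<in> \<F>" "i \<in> Y" "b \<in> E Y" by blast
        moreover have "Y = X" using calculation X F(3) by (auto simp: disjoint_def)
        ultimately show "b \<in> E X" by simp
      qed
      then show ?thesis using card_mono[OF finE[OF X(1)]] E(2)[OF X(1)] by simp
    qed simp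
  qed
  ultimately show ?thesis using that by blast
qed

text \<open>All removed elements cover only sums involving \<open>R\<close>. At least one is removed
  for \<open>R + R\<close>, and exactly one for each class.\<close>

lemma peeled_delete:
  assumes peel: "peeled S A m R" and finB: "finite B" and cov: "S + S \<subseteq> A + B"
  obtains B' where "finite B'" "(S - R) + (S - R) \<subseteq> A + B'" "card B' + 1 + m \<le> card B"
proof -
  have RS: "R \<subseteq> S" "R \<noteq> {}" using peel by (auto simp: peeled_def)
  have fint: "finite (touched A B R X)" for X using finB by (simp add: touched_def)
  have "1 \<le> card (touched A B R {i})" if i: "i \<in> S - R" for i
  proof -
    obtain u where u: "u \<in> R" using RS by blast
    obtain b where "b \<in> B" "u + i - b \<in> A" using covered_sum[OF cov, of u i] u i RS by blast
    then have "touched A B R {i} \<noteq> {}" using u by (auto simp: touched_def)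
    then show ?thesis using fint by (simp add: Suc_le_eq card_gt_0_iff)
  qed
  then obtain D where D: "D \<subseteq> B" "card D = card (touched A B R R) + m * 1"
    "\<And>b k l. b \<in> D \<Longrightarrow> k \<in> S \<Longrightarrow> l \<in> S \<Longrightarrow> k + l - b \<in> A \<Longrightarrow>
      k \<in> R \<and> l \<in> R \<and> b \<in> touched A B R R \<or> k \<in> R \<and> l \<notin> R \<or> k \<notin> R \<and> l \<in> R"
    using peeled_removal[OF peel finB, of "touched A B R R" 1] by (metis subset_refl)
  have "touched A B R R \<noteq> {}"
  proof -
    obtain u where u: "u \<in> R" using RS by blast
    obtain b where "b \<in> B" "u + u - b \<in> A" using covered_sum[OF cov, of u u] u RS by blast
    then show ?thesis using u by (auto simp: touched_def)
  qed
  then have "1 \<le> card (touched A B R R)" using fint by (simp add: Suc_le_eq card_gt_0_iff)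
  moreover have "card (B - D) = card B - card D" using D(1) finB by (meson card_Diff_subset finite_subset)
  moreover have "card D \<le> card B" using D(1) finB by (rule card_mono[rotated])
  ultimately have "card (B - D) + 1 + m \<le> card B" using D(2) by linarith
  moreover have "(S - R) + (S - R) \<subseteq> A + (B - D)"
  proof
    fix v assume "v \<in> (S - R) + (S - R)"
    then obtain k l where kl: "k \<in> S - R" "l \<in> S - R" "v = k + l" by (rule set_plus_elim)
    obtain b where b: "b \<in> B" "k + l - b \<in> A" using covered_sum[OF cov, of k l] kl by blast
    then have "b \<notin> D" using D(3)[of b k l] kl by blast
    then have "(k + l - b) + b \<in> A + (B - D)" using b by (blast intro: set_plus_intro)
    then show "v \<in> A + (B - D)" using kl by simp
  qed
  ultimately show ?thesis using finB by (intro that[of "B - D"]) auto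
qed

text \<open>After the collapse, \<open>R + R\<close> and each \<open>R + {i}\<close> become single
  points, so one surviving element suffices for each; sums avoiding \<open>R\<close> lose no
  covering element.\<close>

lemma peeled_merge:
  fixes A B S R :: "'a::real_vector set"
  assumes peel: "peeled S A m R" and finB: "finite B" and cov: "S + S \<subseteq> A + B"
    and f: "linear f" "\<forall>s\<in>R. f s = c" "\<forall>s\<in>S - R. f s = s"
    and many: "\<And>i. i \<in> S - R \<Longrightarrow> \<tau> < card (touched A B R {i})"
  obtains B' where "finite B'" "f ` S + f ` S \<subseteq> f ` A + B'"
    "card B' + card (touched A B R R) + m * \<tau> \<le> card B + 1"
proof -
  have RS: "R \<subseteq> S" "R \<noteq> {}" using peel by (auto simp: peeled_def)
  have fint: "finite (touched A B R X)" for X using finB by (simp add: touched_def)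
  obtain u where u: "u \<in> R" using RS by blast
  obtain z where z: "z \<in> B" "u + u - z \<in> A" using covered_sum[OF cov, of u u] u RS by blast
  then have zt: "z \<in> touched A B R R" using u by (auto simp: touched_def)
  \<comment> \<open>\<open>z\<close> is kept to cover \<open>c + c\<close>; this is the
    \<open>+ 1\<close> in the final count.\<close>
  let ?D0 = "touched A B R R - {z}"
  obtain D where D: "D \<subseteq> B" "card D = card ?D0 + m * \<tau>"
    "\<And>b k l. b \<in> D \<Longrightarrow> k \<in> S \<Longrightarrow> l \<in> S \<Longrightarrow> k + l - b \<in> A \<Longrightarrow>
      k \<in> R \<and> l \<in> R \<and> b \<in> ?D0 \<or> k \<in> R \<and> l \<notin> R \<or> k \<notin> R \<and> l \<in> R"
    "\<And>i. i \<in> S - R \<Longrightarrow> card (D \<inter> touched A B R {i}) \<le> \<tau>"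
    using peeled_removal[OF peel finB, of ?D0 \<tau>] many less_imp_le by (metis Diff_subset)
  have zD: "z \<notin> D" using D(3)[of z u u] z u RS by blast
  have img: "f k + f l \<in> f ` A + f ` (B - D)" if "b \<in> B - D" "k + l - b \<in> A" for k l b
  proof -
    have "f (k + l - b) + f b \<in> f ` A + f ` (B - D)" using that by (intro set_plus_intro imageI)
    then show ?thesis using f(1) by (simp add: linear_add linear_diff)
  qed
  have RI: "c + f i \<in> f ` A + f ` (B - D)" if i: "i \<in> S - R" for i
  proof -
    \<comment> \<open>More than \<open>\<tau>\<close> elements touch \<open>i\<close>, and at most
      \<open>\<tau>\<close> of them were removed.\<close>
    have "\<not> touched A B R {i} \<subseteq> D"
      using D(4)[OF i] many[OF i] by (metis inf.absorb2 leD)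
    then obtain b where b: "b \<in> touched A B R {i}" "b \<notin> D" by blast
    then obtain u where "u \<in> R" "u + i - b \<in> A" "b \<in> B" by (auto simp: touched_def)
    then show ?thesis using img[of b u i] f(2) b by simp
  qed
  have "f ` S + f ` S \<subseteq> f ` A + f ` (B - D)"
  proof
    fix v assume "v \<in> f ` S + f ` S"
    then obtain k l where kl: "k \<in> S" "l \<in> S" "v = f k + f l" by (auto elim!: set_plus_elim)
    consider "k \<in> R" "l \<in> R" | "k \<in> R" "l \<notin> R" | "k \<notin> R" "l \<in> R" | "k \<notin> R" "l \<notin> R" by blast
    then show "v \<in> f ` A + f ` (B - D)"
    proof cases
      case 1
      then show ?thesis using img[of z u u] z zD u f(2) kl by simp
    next
      case 2
      then show ?thesis using RI[of l] kl f(2) by simp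
    next
      case 3
      then show ?thesis using RI[of k] kl f(2) by (simp add: add.commute)
    next
      case 4
      obtain b where b: "b \<in> B" "k + l - b \<in> A" using covered_sum[OF cov kl(1,2)] by blast
      then have "b \<notin> D" using D(3)[of b k l] kl 4 by blast
      then show ?thesis using img[of b k l] b kl by simp
    qed
  qed
  moreover have "card (f ` (B - D)) + card (touched A B R R) + m * \<tau> \<le> card B + 1"
  proof -
    have "card (f ` (B - D)) \<le> card (B - D)" using finB by (intro card_image_le) auto
    moreover have "card (B - D) = card B - card D" using D(1) finB by (meson card_Diff_subset finite_subset)
    moreover have "card D \<le> card B" using D(1) finB by (rule card_mono[rotated])
    moreover have "card ?D0 = card (touched A B R R) - 1" using zt by (rule card_Diff_singleton)
    moreover have "1 \<le> card (touched A B R R)" using fint zt by (auto simp: Suc_le_eq card_gt_0_iff)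
    ultimately show ?thesis using D(2) by linarith
  qed
  ultimately show ?thesis using finB by (intro that[of "f ` (B - D)"]) blast+
qed

section \<open>The induction on the size of \<open>S\<close>\<close>

lemma exists_collapse:
  fixes S R :: "'a::real_vector set"
  assumes "independent S"
  shows "\<exists>f :: 'a \<Rightarrow> 'a. linear f \<and> (\<forall>s\<in>R \<inter> S. f s = c) \<and> (\<forall>s\<in>S - R. f s = s)"
proof -
  obtain f :: "'a \<Rightarrow> 'a" where f: "linear f" "\<forall>s\<in>S. f s = (if s \<in> R then c else s)"
    using linear_independent_extend[OF assms, of "\<lambda>s. if s \<in> R then c else s"] by blast
  then show ?thesis by (intro exI[of _ f]) simp
qed

text \<open>The form for independent sets instead of bases serves the induction, which passes to
  \<open>R\<close>, to \<open>S - R\<close> and to the collapsed image of \<open>S\<close>.\<close>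

theorem sumset_cover_bound:
  fixes S A B :: "'a::euclidean_space set"
  assumes "independent S" "finite A" "finite B" "S + S \<subseteq> A + B" "card A \<le> card S"
  shows "card S + (card S - card A + 1 choose 2) \<le> card B"
  using assms
proof (induction "card S" arbitrary: S A B rule: less_induct)
  case less
  note indS = less.prems(1)
  have finS: "finite S" using independent_imp_finite[OF indS] .
  \<comment> \<open>\<open>A\<close> and \<open>B\<close> are quantified anew so that they can be
    exchanged when \<open>card A = card S\<close>.\<close>
  have strict: "card S + (card S - card A + 1 choose 2) \<le> card B"
    if finA: "finite A" and finB: "finite B" and cov: "S + S \<subseteq> A + B" and lt: "card A < card S" for A B
  proof -
    define t where "t = card S - card A"
    have t: "0 < t" "card S = card A + t" using lt by (auto simp: t_def)
    have Sne: "S \<noteq> {}" using lt by auto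
    then obtain s where s: "s \<in> S" by blast
    have "A \<noteq> {}"
    proof -
      obtain b where "s + s - b \<in> A" using covered_sum[OF cov s s] by blast
      then show ?thesis by blast
    qed
    \<comment> \<open>\<open>g\<close> collapses all of \<open>S\<close>; that the image of
      \<open>A\<close> is nonempty already gives the inequality of \<open>exists_peeled\<close> for
      \<open>m = t\<close>.\<close>
    obtain g :: "'a \<Rightarrow> 'a" where g: "linear g" "\<forall>u\<in>S \<inter> S. g u = s"
      using exists_collapse[OF indS, of S s] by blast
    have "0 < card (g ` A)" using \<open>A \<noteq> {}\<close> finA by (simp add: card_gt_0_iff)
    then have "\<exists>T. peeled S A t T"
      using exists_peeled[OF indS _ Sne _ finA g(1), of s t] g(2) t by (auto simp: isolated_def)
    then obtain R where R: "peeled S A t R" and min: "\<And>T. peeled S A t T \<Longrightarrow> card R \<le> card T"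
      using ex_has_least_nat[of "peeled S A t" _ card] by blast
    have RS: "R \<subseteq> S" "R \<noteq> {}" "isolated S A R R" using R by (auto simp: peeled_def)
    have "R \<noteq> S"
      using R t(1) unfolding peeled_def
      by (metis Diff_cancel card.empty ex_in_conv less_numeral_extra(3) subset_empty)
    then have Rlt: "card R < card S" using RS finS by (simp add: psubset_card_mono psubsetI)
    have finR: "finite R" using RS(1) finS finite_subset by blast
    obtain r where r: "r \<in> R" using RS by blast
    have Rpos: "0 < card R" using finR RS by (simp add: card_gt_0_iff)
    show ?thesis
    proof (cases "card R = 1")
      case True
      obtain B' where B': "finite B'" "(S - R) + (S - R) \<subseteq> A + B'" "card B' + 1 + t \<le> card B"
        using peeled_delete[OF R finB cov] by blast
      have c: "card (S - R) = card S - 1" using True RS finR by (simp add: card_Diff_subset)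
      have e: "card (S - R) - card A = t - 1" using c t by auto
      have "card (S - R) + (t - 1 + 1 choose 2) \<le> card B'"
        unfolding e[symmetric] using c t finA B' independent_mono[OF indS] by (intro less.hyps) auto
      \<comment> \<open>The \<open>t + 1\<close> freed elements pay for the deleted point of
        \<open>S\<close> and for this difference of binomials.\<close>
      moreover have "(t + 1 choose 2) = (t - 1 + 1 choose 2) + t"
        using t(1) by (cases t) (simp_all add: numeral_2_eq_2)
      moreover have "card S = card (S - R) + 1" using c t by auto
      ultimately show ?thesis using B'(3) unfolding t_def[symmetric] by linarith
    next
      case False
      obtain f :: "'a \<Rightarrow> 'a" where f: "linear f" "\<forall>u\<in>R \<inter> S. f u = r" "\<forall>u\<in>S - R. f u = u"
        using exists_collapse[OF indS, of R r] by blast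
      have fR: "\<forall>u\<in>R. f u = r" using f(2) RS by blast
      have fS: "f ` S = insert r (S - R)"
      proof -
        have "f ` S = f ` R \<union> f ` (S - R)" using RS(1) by blast
        moreover have "f ` R = {r}" using fR r by auto
        moreover have "f ` (S - R) = S - R" using f(3) by simp
        ultimately show ?thesis by simp
      qed
      have cfS: "card (f ` S) + card R = card S + 1"
        unfolding fS using r finS finR RS card_mono[OF finS RS(1)] by (simp add: card_Diff_subset)
      have fSS: "f ` S \<subseteq> S" using fS r RS by auto
      have fA: "card (f ` A) \<le> card A" using finA by (rule card_image_le)
      \<comment> \<open>This is \<open>\<tau> < t\<close> in the overview: otherwise a proper subset
        of \<open>R\<close> would be peeled, against minimality.\<close>
      have small: "card R + card (f ` A) < card A + 1 + t"
      proof (rule ccontr)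
        assume "\<not> ?thesis"
        then obtain T where "T \<subseteq> R" "peeled S A t T" "T \<noteq> R"
          using exists_peeled[OF indS RS(1,2,3) finA f(1) fR, of t] t(1) by (metis not_less add.assoc)
        then have "card T < card R" by (intro psubset_card_mono[OF finR] psubsetI)
        then show False using min[OF \<open>peeled S A t T\<close>] by simp
      qed
      define z where "z = card (touched A B R R)"
      have z: "2 * card R + card (f ` A) \<le> z + card A + 1"
        unfolding z_def
      proof (rule merged_sum_bound[OF _ finA _ f(1) fR])
        show "finite (touched A B R R)" using finB by (simp add: touched_def)
        show "R + R \<subseteq> A + touched A B R R"
        proof
          fix v assume "v \<in> R + R"
          then obtain k l where kl: "k \<in> R" "l \<in> R" "v = k + l" by (rule set_plus_elim)
          obtain b where b: "b \<in> B" "k + l - b \<in> A" using covered_sum[OF cov, of k l] kl RS by blast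
          then have "(k + l - b) + b \<in> A + touched A B R R"
            using kl by (intro set_plus_intro) (auto simp: touched_def)
          then show "v \<in> A + touched A B R R" using kl by simp
        qed
        \<comment> \<open>If one of the two sets has at most \<open>card R\<close> elements, the
          induction hypothesis for \<open>R\<close> bounds the other; if neither has, the claim is
          immediate.\<close>
        show "2 * card R \<le> card A' + card B'"
          if "finite A'" "finite B'" "R + R \<subseteq> A' + B'" for A' B' :: "'a set"
        proof (cases "card A' \<le> card R")
          case True
          have "card R + (card R - card A' + 1 choose 2) \<le> card B'"
            using Rlt that True independent_mono[OF indS RS(1)] by (intro less.hyps) auto
          moreover have "card R - card A' \<le> (card R - card A' + 1 choose 2)"
            using choose_two_add_le[of 0 "card R - card A'"] by simp
          ultimately show ?thesis by linarith
        next
          case A': False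
          show ?thesis
          proof (cases "card B' \<le> card R")
            case True
            have "card R + (card R - card B' + 1 choose 2) \<le> card A'"
              using Rlt that True independent_mono[OF indS RS(1)]
              by (intro less.hyps) (auto simp: add.commute)
            moreover have "card R - card B' \<le> (card R - card B' + 1 choose 2)"
              using choose_two_add_le[of 0 "card R - card B'"] by simp
            ultimately show ?thesis by linarith
          qed (use A' in linarith)
        qed
      qed
      \<comment> \<open>Truncated subtraction makes this the \<open>max(\<tau>, 0)\<close> of the
        overview.\<close>
      define \<tau> where "\<tau> = card R + card (f ` A) - (card A + 1)"
      have many: "\<tau> < card (touched A B R {i})" if i: "i \<in> S - R" for i
      proof -
        have fint: "finite (touched A B R {i})" using finB by (simp add: touched_def)
        have hit: "\<exists>b\<in>touched A B R {i}. u + i - b \<in> A" if "u \<in> R" for u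
          using covered_sum[OF cov, of u i] that i RS(1) unfolding touched_def by blast
        have "independent (insert i R)" "i \<notin> R"
          using independent_mono[OF indS, of "insert i R"] i RS(1) by auto
        then have "card R + card (f ` A) \<le> card (touched A B R {i}) + card A"
          by (rule merged_star_bound[OF _ _ finA fint f(1) fR hit])
        \<comment> \<open>Needed when \<open>\<tau>\<close> is truncated to 0.\<close>
        moreover have "0 < card (touched A B R {i})" using hit[OF r] fint by (auto simp: card_gt_0_iff)
        ultimately show ?thesis unfolding \<tau>_def by linarith
      qed
      obtain B' where B': "finite B'" "f ` S + f ` S \<subseteq> f ` A + B'"
        "card B' + z + t * \<tau> \<le> card B + 1"
        using peeled_merge[OF R finB cov f(1) fR f(3) many] unfolding z_def by blast
      have IH: "card (f ` S) + (card (f ` S) - card (f ` A) + 1 choose 2) \<le> card B'"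
        if "card (f ` A) \<le> card (f ` S)"
        using that False Rpos cfS finA B' independent_mono[OF indS fSS] by (intro less.hyps) auto
      show ?thesis
      proof (cases "card A + 1 \<le> card R + card (f ` A)")
        case True
        then have \<tau>: "card R + card (f ` A) = card A + 1 + \<tau>" by (simp add: \<tau>_def)
        \<comment> \<open>\<open>x\<close> is the value of \<open>t\<close> after the
          collapse.\<close>
        obtain x where x: "t = x + \<tau>" using small \<tau> by (intro that[of "t - \<tau>"]) simp
        have d: "card (f ` S) = card (f ` A) + x" using cfS \<tau> t x by linarith
        have "card (f ` S) + (x + 1 choose 2) \<le> card B'" using IH d by simp
        moreover have "(t + 1 choose 2) \<le> (x + 1 choose 2) + t * \<tau> + \<tau>"
          using choose_two_diff_le[of x \<tau>] x by simp
        ultimately show ?thesis using B'(3) z \<tau> cfS unfolding t_def[symmetric] by linarith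
      next
        case False
        \<comment> \<open>\<open>t\<close> grows by \<open>d\<close> under the collapse; this gain
          offsets the weaker bound \<open>z \<ge> card R - d\<close>.\<close>
        define d where "d = card A + 1 - (card R + card (f ` A))"
        have d: "card A + 1 = card R + card (f ` A) + d" using False by (simp add: d_def)
        have e: "card (f ` S) = card (f ` A) + (t + d)" using cfS d t by linarith
        have "card (f ` S) + (t + d + 1 choose 2) \<le> card B'" using IH e by simp
        moreover have "(t + 1 choose 2) + d \<le> (t + d + 1 choose 2)" by (rule choose_two_add_le)
        ultimately show ?thesis using B'(3) z d cfS unfolding t_def[symmetric] by linarith
      qed
    qed
  qed
  show ?case
  proof (cases "card A < card S")
    case True
    then show ?thesis using strict less.prems by blast
  next
    case False
    then have eq: "card A = card S" using less.prems by simp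
    have "card S \<le> card B"
    proof (rule ccontr)
      assume "\<not> ?thesis"
      then have lt: "card B < card S" by simp
      \<comment> \<open>With the roles exchanged, a set \<open>B\<close> smaller than
        \<open>S\<close> would force \<open>A\<close> to be larger than \<open>S\<close>.\<close>
      have "card S + (card S - card B + 1 choose 2) \<le> card A"
        using strict[OF less.prems(3,2) _ lt] less.prems(4) by (simp add: add.commute)
      moreover have "0 < (card S - card B + 1 choose 2)" using lt by simp
      ultimately show False using eq by linarith
    qed
    then show ?thesis using eq by (simp add: numeral_2_eq_2)
  qed
qed

theorem theorem1p1:
  fixes S A B :: "(real ^ 'n) set" and t :: nat
  assumes "independent S" and "span S = UNIV"
    and "S + S \<subseteq> A + B"
    and "t \<le> CARD('n) - 1"
    and "finite A" and "card A \<le> CARD('n) - t"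
  shows "infinite B \<or> card B \<ge> CARD('n) + (t + 1 choose 2)"
proof (cases "finite B")
  case True
  have "card S = CARD('n)"
    using dim_eq_card[of S UNIV] assms(1,2) by simp
  then have "CARD('n) + (CARD('n) - card A + 1 choose 2) \<le> card B"
    using sumset_cover_bound[OF assms(1,5) True assms(3)] assms(6) by simp
  \<comment> \<open>The bound on \<open>t\<close> ensures that \<open>CARD('n) - t\<close> is not
    truncated.\<close>
  moreover have "t \<le> CARD('n) - card A"
    using assms(4,6) zero_less_card_finite[where 'a = 'n] by linarith
  then obtain d where "CARD('n) - card A = t + d" by (auto simp: le_iff_add)
  then have "(t + 1 choose 2) \<le> (CARD('n) - card A + 1 choose 2)"
    using choose_two_add_le[of t d] by simp
  ultimately show ?thesis by simp
qed simp

end
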